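(* Let $n\ge 1$, $T>0$, $I=[0,T]$, $x_0\in\mathbb{R}^n$, and let $F:\mathbb{R}^n\rightrightarrows\mathbb{R}^n$ be a set-valued map satisfying the following three conditions. (A1) $F$ has nonempty compact values and its graph $\{(x,v): v\in F(x)\}$ is closed in $\mathbb{R}^n\times\mathbb{R}^n$. (A2) There exist constants $A$ and $B$ such that $\|F(x)\|\le A+B|x|$ for every $x\in\mathbb{R}^n$. (A3) For every $x,y\in\mathbb{R}^n$ and every $v\in F(x)$ there exists $w\in F(y)$ such that $$(x_j-y_j)(v_j-w_j)\ge 0\quad\text{for all } j=1,2,\ldots,n.$$ Then the differential inclusion $$\dot x(t)\in F(x(t)),\qquad x(0)=x_0,\qquad t\in I=[0,T],$$ has a solution.
   Context: $|v|$ denotes the Euclidean norm of $v\in\mathbb{R}^n$ and $v_j$ its $j$-th coordinate. For a bounded set $S\subset\mathbb{R}^n$, $\|S\|=\sup\{|a|: a\in S\}$. The values of $F$ are not assumed convex. A solution of the differential inclusion is an absolutely continuous function $x:[0,T]\to\mathbb{R}^n$ with $x(0)=x_0$ and $\dot x(t)\in F(x(t))$ for almost every $t\in[0,T]$. *)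

theory Defs
  imports "HOL-Analysis.Analysis"
begin

text \<open>
  The library constant \<open>absolutely_continuous\<close> relates two measures. The following is the notion
  for functions of a real variable. A finite family of non-overlapping intervals is encoded as
  the finite set of its pairs of endpoints.
\<close>

definition absolutely_continuous_on :: "real set \<Rightarrow> (real \<Rightarrow> 'a::real_normed_vector) \<Rightarrow> bool" where
  "absolutely_continuous_on S f \<longleftrightarrow>
    (\<forall>\<epsilon>>0. \<exists>\<delta>>0. \<forall>P :: (real \<times> real) set.
      finite P \<and>
      (\<forall>(a, b)\<in>P. a < b \<and> {a..b} \<subseteq> S) \<and>
      pairwise (\<lambda>(a, b) (c, d). {a<..<b} \<inter> {c<..<d} = {}) P \<and>
      (\<Sum>(a, b)\<in>P. b - a) < \<delta>
      \<longrightarrow> (\<Sum>(a, b)\<in>P. norm (f b - f a)) < \<epsilon>)"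

text \<open>
  Only meaningful for nonempty bounded \<open>S\<close>, as the supremum is taken in the reals.
\<close>

definition set_norm :: "'a::real_normed_vector set \<Rightarrow> real" where
  "set_norm S = (SUP a\<in>S. norm a)"

text \<open>
  A function on \<open>[0, T]\<close> is represented by a total function whose values outside \<open>[0, T]\<close>
  are irrelevant; hence the one-sided derivative at the endpoints.
\<close>

definition is_solution ::
  "('a::real_normed_vector \<Rightarrow> 'a set) \<Rightarrow> 'a \<Rightarrow> real \<Rightarrow> (real \<Rightarrow> 'a) \<Rightarrow> bool" where
  "is_solution F x0 T x \<longleftrightarrow>
    absolutely_continuous_on {0..T} x \<and>
    x 0 = x0 \<and>
    (AE t in lebesgue_on {0..T}.
      \<exists>v\<in>F (x t). (x has_vector_derivative v) (at t within {0..T}))"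

end

theory Submission
  imports Defs "HOL-Probability.Helly_Selection"
begin

text \<open>
  Run the Euler scheme \<open>u (k + 1) = u k + h v k\<close> and use (A3) with \<open>x = u k\<close>, \<open>y = u (k + 1)\<close> to
  choose \<open>v (k + 1) \<in> F (u (k + 1))\<close>. Since \<open>y - x = h v k\<close>, this gives
  \<open>v k $ j * (v (k + 1) $ j - v k $ j) \<ge> 0\<close>: a coordinate of the velocity may leave the value \<open>0\<close>
  once, and afterwards moves away from it monotonically. So every coordinate of the
  velocity is monotone in time, and by the growth bound it is bounded uniformly in \<open>h\<close>.
  Helly's theorem gives velocities that converge outside a countable set, hence the Euler
  polygons converge as well, and the closed graph yields the inclusion without any convexity.
\<close>

subsection \<open>Absolute continuity and selection\<close>

lemma lipschitz_on_imp_absolutely_continuous_on: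
  assumes "C-lipschitz_on S f"
  shows "absolutely_continuous_on S f"
  unfolding absolutely_continuous_on_def
proof (intro allI impI)
  fix e :: real assume e: "e > 0"
  have C: "C \<ge> 0" using assms by (rule lipschitz_on_nonneg)
  show "\<exists>\<delta>>0. \<forall>P :: (real \<times> real) set.
      finite P \<and> (\<forall>(a, b)\<in>P. a < b \<and> {a..b} \<subseteq> S) \<and>
      pairwise (\<lambda>(a, b) (c, d). {a<..<b} \<inter> {c<..<d} = {}) P \<and>
      (\<Sum>(a, b)\<in>P. b - a) < \<delta> \<longrightarrow> (\<Sum>(a, b)\<in>P. norm (f b - f a)) < e"
  \<comment> \<open>The Lipschitz constant may be 0; \<open>C + 1\<close> keeps the quotient
    positive and the final estimate strict.\<close>
  proof (intro exI[of _ "e / (C + 1)"] conjI allI impI, goal_cases)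
    case 1
    show ?case using C e by simp
  next
    case (2 P)
    have "norm (f (snd p) - f (fst p)) \<le> (C + 1) * (snd p - fst p)" if "p \<in> P" for p
    proof -
      have "case p of (a, b) \<Rightarrow> a < b \<and> {a..b} \<subseteq> S" using 2 that by blast
      then have *: "fst p < snd p" "{fst p..snd p} \<subseteq> S" by (simp_all add: case_prod_beta)
      then have "fst p \<in> S" "snd p \<in> S" by auto
      then have "norm (f (snd p) - f (fst p)) \<le> C * (snd p - fst p)"
        using lipschitz_onD[OF assms, of "snd p" "fst p"] * by (simp add: dist_norm)
      also have "\<dots> \<le> (C + 1) * (snd p - fst p)"
        using * by (intro mult_right_mono) auto
      finally show ?thesis .
    qed
    then have "(\<Sum>(a, b)\<in>P. norm (f b - f a)) \<le> (C + 1) * (\<Sum>(a, b)\<in>P. b - a)"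
      unfolding sum_distrib_left by (intro sum_mono) (auto simp: case_prod_beta)
    also have "\<dots> < (C + 1) * (e / (C + 1))"
      using 2 C by (intro mult_strict_left_mono) auto
    also have "\<dots> = e" using C by simp
    finally show ?case .
  qed
qed

text \<open>By pigeonhole, one sign \<open>\<sigma>\<close> makes \<open>\<sigma> * f n\<close>
  monotone for infinitely many \<open>n\<close>. Helly's theorem applies along these, and a second
  multiplication by \<open>\<sigma>\<close> undoes the sign.\<close>

lemma Helly_selection_mono_or_antimono:
  fixes f :: "nat \<Rightarrow> real \<Rightarrow> real"
  assumes rcont: "\<And>n x. continuous (at_right x) (f n)"
    and mono: "\<And>n. mono (f n) \<or> antimono (f n)"
    and bdd: "\<And>n x. \<bar>f n x\<bar> \<le> M"
  shows "\<exists>s G. strict_mono (s::nat \<Rightarrow> nat) \<and> countable {x. \<not> isCont G x} \<and> (\<forall>x. \<bar>G x\<bar> \<le> M) \<and>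
    (\<forall>x. isCont G x \<longrightarrow> (\<lambda>n. f (s n) x) \<longlonglongrightarrow> G x)"
proof -
  have "\<exists>\<sigma>. \<bar>\<sigma>\<bar> = 1 \<and> infinite {n. mono (\<lambda>x. \<sigma> * f n x)}"
  proof (rule ccontr)
    assume *: "\<not> ?thesis"
    then have "finite {n. mono (\<lambda>x. \<sigma> * f n x)}" if "\<bar>\<sigma>\<bar> = 1" for \<sigma>
      using that by blast
    from this[of 1] this[of "-1"]
    have "finite {n. mono (\<lambda>x. 1 * f n x)}" "finite {n. mono (\<lambda>x. (-1) * f n x)}"
      by simp_all
    moreover have "UNIV = {n. mono (\<lambda>x. 1 * f n x)} \<union> {n. mono (\<lambda>x. (-1) * f n x)}"
      using mono by (auto simp: monotone_def)
    ultimately show False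
      by (metis finite_Un infinite_UNIV_nat)
  qed
  then obtain \<sigma> where \<sigma>: "\<bar>\<sigma>\<bar> = 1" and inf: "infinite {n. mono (\<lambda>x. \<sigma> * f n x)}"
    by blast
  from infinite_enumerate[OF inf] obtain r :: "nat \<Rightarrow> nat"
    where r: "strict_mono r" "\<And>n. mono (\<lambda>x. \<sigma> * f (r n) x)" by blast
  have \<sigma>\<sigma>: "\<sigma> * \<sigma> = 1" using \<sigma> by (auto simp: abs_if split: if_splits)
  have "continuous (at_right x) (\<lambda>x. \<sigma> * f (r n) x)" for n x
    using rcont by (intro continuous_intros)
  moreover have "\<bar>\<sigma> * f (r n) x\<bar> \<le> M" for n x
    using bdd \<sigma> by (simp add: abs_mult)
  ultimately obtain s G where s: "strict_mono s" "mono G" "\<And>x. \<bar>G x\<bar> \<le> M"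
    and lim: "\<And>x. isCont G x \<Longrightarrow> (\<lambda>n. \<sigma> * f (r (s n)) x) \<longlonglongrightarrow> G x"
    using Helly_selection[of "\<lambda>n x. \<sigma> * f (r n) x" M] r(2) by blast
  have cont: "isCont G x" if "isCont (\<lambda>x. \<sigma> * G x) x" for x
    using continuous_mult_left[OF that, of \<sigma>] by (simp add: mult.assoc[symmetric] \<sigma>\<sigma>)
  have cont': "isCont (\<lambda>x. \<sigma> * G x) x" if "isCont G x" for x
    using that by (intro continuous_intros)
  show ?thesis
  proof (intro exI conjI allI impI)
    show "strict_mono (r \<circ> s)" using r(1) s(1) by (rule strict_mono_o)
    show "countable {x. \<not> isCont (\<lambda>x. \<sigma> * G x) x}"
      using mono_ctble_discont[OF s(2)] by (rule countable_subset[rotated]) (use cont' in blast)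
    show "\<bar>\<sigma> * G x\<bar> \<le> M" for x using s(3) \<sigma> by (simp add: abs_mult)
    fix x assume "isCont (\<lambda>x. \<sigma> * G x) x"
    from tendsto_mult_left[OF lim[OF cont[OF this]], of \<sigma>]
    show "(\<lambda>n. f ((r \<circ> s) n) x) \<longlonglongrightarrow> \<sigma> * G x"
      by (simp add: mult.assoc[symmetric] \<sigma>\<sigma>)
  qed
qed

text \<open>The indices are treated one at a time, each along the subsequence already found;
  thinning it further preserves convergence for the earlier indices. This serves all velocity
  coordinates with one common subsequence.\<close>

lemma Helly_selection_finite:
  fixes f :: "'i \<Rightarrow> nat \<Rightarrow> real \<Rightarrow> real"
  assumes "finite I"
    and rcont: "\<And>i n x. continuous (at_right x) (f i n)"
    and mono: "\<And>i n. mono (f i n) \<or> antimono (f i n)"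
    and bdd: "\<And>i n x. \<bar>f i n x\<bar> \<le> M"
  shows "\<exists>s G. strict_mono (s::nat \<Rightarrow> nat) \<and> (\<forall>i\<in>I. countable {x. \<not> isCont (G i) x} \<and>
    (\<forall>x. \<bar>G i x\<bar> \<le> M) \<and> (\<forall>x. isCont (G i) x \<longrightarrow> (\<lambda>n. f i (s n) x) \<longlonglongrightarrow> G i x))"
  using assms(1)
proof (induction I)
  case empty
  show ?case by (auto intro: strict_mono_id)
next
  case (insert i I)
  then obtain s G where s: "strict_mono (s::nat \<Rightarrow> nat)"
    and G: "\<forall>i\<in>I. countable {x. \<not> isCont (G i) x} \<and>
      (\<forall>x. \<bar>G i x\<bar> \<le> M) \<and> (\<forall>x. isCont (G i) x \<longrightarrow> (\<lambda>n. f i (s n) x) \<longlonglongrightarrow> G i x)"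
    by blast
  obtain r H where r: "strict_mono (r::nat \<Rightarrow> nat)" and H: "countable {x. \<not> isCont H x}"
      "\<forall>x. \<bar>H x\<bar> \<le> M" "\<forall>x. isCont H x \<longrightarrow> (\<lambda>n. f i (s (r n)) x) \<longlonglongrightarrow> H x"
    using Helly_selection_mono_or_antimono[of "\<lambda>n. f i (s n)" M, OF rcont mono bdd] by blast
  have lim: "(\<lambda>n. f k (s (r n)) x) \<longlonglongrightarrow> G k x" if "k \<in> I" "isCont (G k) x" for k x
    using LIMSEQ_subseq_LIMSEQ[of "\<lambda>n. f k (s n) x" "G k x" r] that G r by (simp add: o_def)
  show ?case
    using strict_mono_o[OF s r] G H lim insert.hyps(2)
    by (intro exI[of _ "s \<circ> r"] exI[of _ "G(i := H)"]) (auto simp: o_def)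
qed

text \<open>A nonzero term passes its sign on to all later terms, so positive and negative terms
  cannot both occur. With the sign settled, each step can only lead away from 0.\<close>

lemma incseq_or_decseq_if_no_sign_change:
  fixes a :: "nat \<Rightarrow> real"
  assumes step: "\<And>k. a k * (a (Suc k) - a k) \<ge> 0"
  shows "incseq a \<or> decseq a"
proof -
  have pos: "a m > 0" if "a k > 0" "k \<le> m" for k m
    using that(2,1)
  proof (induction m rule: dec_induct)
    case (step m)
    with assms[of m] show ?case by (simp add: zero_le_mult_iff)
  qed
  have neg: "a m < 0" if "a k < 0" "k \<le> m" for k m
    using that(2,1)
  proof (induction m rule: dec_induct)
    case (step m)
    with assms[of m] show ?case by (simp add: zero_le_mult_iff)
  qed
  show ?thesis
  proof (cases "\<exists>k. a k > 0")
    case True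
    then obtain k where k: "a k > 0" by blast
    have nonneg: "a m \<ge> 0" for m
      using neg[of m k] pos[OF k, of m] k by (cases "m \<le> k") force+
    \<comment> \<open>At \<open>a m = 0\<close> the sign condition is void; there the increase comes
      from the nonnegativity of the next term.\<close>
    have "a m \<le> a (Suc m)" for m
      using nonneg[of m] nonneg[of "Suc m"] step[of m]
      by (cases "a m = 0") (auto simp: zero_le_mult_iff)
    then show ?thesis by (simp add: incseq_SucI)
  next
    case False
    have "a (Suc m) \<le> a m" for m
      using False step[of m]
      by (cases "a m = 0") (auto simp: zero_le_mult_iff not_less dest: spec[of _ m] spec[of _ "Suc m"])
    then show ?thesis by (simp add: decseq_SucI)
  qed
qed

text \<open>The floor is constant from \<open>x\<close> up to the next grid point. This supplies the
  right-continuity that Helly's theorem asks for.\<close>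

lemma continuous_at_right_step:
  fixes a :: "nat \<Rightarrow> 'a::topological_space"
  assumes "h > (0::real)"
  shows "continuous (at_right x) (\<lambda>t. a (nat \<lfloor>t / h\<rfloor>))"
proof -
  have "x < h * (of_int \<lfloor>x / h\<rfloor> + 1)"
    using assms floor_less_iff[of "x / h" "\<lfloor>x / h\<rfloor> + 1"] by (simp add: field_simps)
  then have "eventually (\<lambda>t. t \<in> {x<..<h * (of_int \<lfloor>x / h\<rfloor> + 1)}) (at_right x)"
    by (rule eventually_at_right_real)
  then have "eventually (\<lambda>t. a (nat \<lfloor>t / h\<rfloor>) = a (nat \<lfloor>x / h\<rfloor>)) (at_right x)"
  proof eventually_elim
    case (elim t)
    have "x / h \<le> t / h" using elim assms by (simp add: divide_right_mono)
    moreover have "of_int \<lfloor>x / h\<rfloor> \<le> x / h" by simp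
    ultimately have "of_int \<lfloor>x / h\<rfloor> \<le> t / h" by linarith
    moreover have "t / h < of_int \<lfloor>x / h\<rfloor> + 1" using elim assms by (simp add: field_simps)
    ultimately have "\<lfloor>t / h\<rfloor> = \<lfloor>x / h\<rfloor>" by (rule floor_unique)
    then show ?case by simp
  qed
  then show ?thesis
    unfolding continuous_within by (rule tendsto_eventually)
qed

subsection \<open>Euler polygons\<close>

text \<open>A discrete Gronwall inequality: each step multiplies \<open>1 + norm (u k)\<close> by at
  most \<open>1 + M * h \<le> exp (M * h)\<close>. The resulting bound depends on the step size only
  through the elapsed time \<open>h * real k\<close>.\<close>

lemma growth_bound:
  fixes u :: "nat \<Rightarrow> 'a::real_normed_vector"
  assumes step: "\<And>k. norm (u (Suc k) - u k) \<le> h * (M * (1 + norm (u k)))"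
    and "0 \<le> h" "0 \<le> M"
  shows "1 + norm (u k) \<le> exp (M * (h * real k)) * (1 + norm (u 0))"
proof (induction k)
  case (Suc k)
  have "norm (u (Suc k)) \<le> norm (u k) + norm (u (Suc k) - u k)"
    by (metis add.commute diff_add_cancel norm_triangle_ineq)
  then have "1 + norm (u (Suc k)) \<le> (1 + M * h) * (1 + norm (u k))"
    using step[of k] by (simp add: algebra_simps)
  also have "\<dots> \<le> exp (M * h) * (exp (M * (h * real k)) * (1 + norm (u 0)))"
    using Suc assms by (intro mult_mono exp_ge_add_one_self) auto
  also have "\<dots> = exp (M * (h * real (Suc k))) * (1 + norm (u 0))"
    by (simp add: exp_add algebra_simps)
  finally show ?case .
qed simp

lemma has_integral_step:
  fixes u v :: "nat \<Rightarrow> 'a::banach"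
  assumes h: "h > 0" and u: "\<And>k. u (Suc k) = u k + h *\<^sub>R v k"
  shows "((\<lambda>t. v (nat \<lfloor>t / h\<rfloor>)) has_integral (u k - u 0)) {0..h * real k}"
proof (induction k)
  case 0
  show ?case by (simp add: has_integral_refl)
next
  case (Suc k)
  have "((\<lambda>t. v k) has_integral (h * real (Suc k) - h * real k) *\<^sub>R v k) {h * real k..h * real (Suc k)}"
    using has_integral_const_real[of "v k" "h * real k" "h * real (Suc k)"] h
    by (simp add: algebra_simps)
  then have "((\<lambda>t. v (nat \<lfloor>t / h\<rfloor>)) has_integral (h * real (Suc k) - h * real k) *\<^sub>R v k)
      {h * real k..h * real (Suc k)}"
  \<comment> \<open>At the right end of the cell the floor has already jumped to
    \<open>Suc k\<close>; this single point does not affect the integral.\<close>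
  proof (rule has_integral_spike_finite[rotated 2])
    show "finite {h * real (Suc k)}" by simp
    fix t assume "t \<in> {h * real k..h * real (Suc k)} - {h * real (Suc k)}"
    then have "real k \<le> t / h" "t / h < real k + 1" using h by (auto simp: field_simps)
    then have "\<lfloor>t / h\<rfloor> = int k" by (intro floor_unique) auto
    then show "v (nat \<lfloor>t / h\<rfloor>) = v k" by simp
  qed
  from has_integral_combine[OF _ _ Suc this] h show ?case
    by (simp add: u algebra_simps)
qed

text \<open>The initial value plus the integral is the Euler polygon at time \<open>t\<close>. It
  agrees with \<open>u\<close> at the last grid time before \<open>t\<close> and then runs for at
  most time \<open>h\<close> with speed at most \<open>C\<close>. The speed bound is asked for only
  at grid times up to \<open>T\<close>, where the scheme is uniformly bounded.\<close>

lemma step_function_integral: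
  fixes u v :: "nat \<Rightarrow> 'a::banach"
  assumes h: "h > 0" and u: "\<And>k. u (Suc k) = u k + h *\<^sub>R v k"
    and C: "\<And>k. h * real k \<le> T \<Longrightarrow> norm (v k) \<le> C" and t: "0 \<le> t" "t \<le> T"
  shows "(\<lambda>t. v (nat \<lfloor>t / h\<rfloor>)) integrable_on {0..t}"
    and "norm (u 0 + integral {0..t} (\<lambda>t. v (nat \<lfloor>t / h\<rfloor>)) - u (nat \<lfloor>t / h\<rfloor>)) \<le> C * h"
proof -
  let ?f = "\<lambda>t. v (nat \<lfloor>t / h\<rfloor>)" and ?k = "nat \<lfloor>t / h\<rfloor>"
  have fl: "real (nat \<lfloor>s / h\<rfloor>) \<le> s / h" "s / h < real (nat \<lfloor>s / h\<rfloor>) + 1" if "s \<ge> 0" for s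
    using that h by auto
  have k: "h * real ?k \<le> t" "t \<le> h * real (Suc ?k)"
    using fl[OF t(1)] h by (auto simp: field_simps)
  have hi: "(?f has_integral (u m - u 0)) {0..h * real m}" for m
    using h u by (rule has_integral_step)
  then have "?f integrable_on {0..h * real (Suc ?k)}"
    by blast
  then show int: "?f integrable_on {0..t}"
    by (rule integrable_on_subinterval) (use k in auto)
  have bd: "norm (?f s) \<le> C" if "s \<in> {h * real ?k..t}" for s
  proof -
    have "s \<ge> 0" using that h by (auto intro: order_trans[rotated])
    from fl(1)[OF this] h have "h * real (nat \<lfloor>s / h\<rfloor>) \<le> s" by (simp add: field_simps)
    then show ?thesis using C that t by auto
  qed
  have "integral {0..t} ?f = integral {0..h * real ?k} ?f + integral {h * real ?k..t} ?f"
    using Henstock_Kurzweil_Integration.integral_combine[of 0 "h * real ?k" t ?f] h k int by simp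
  also have "integral {0..h * real ?k} ?f = u ?k - u 0"
    using hi by (rule integral_unique)
  finally have "u 0 + integral {0..t} ?f - u ?k = integral {h * real ?k..t} ?f" by simp
  moreover have "?f integrable_on {h * real ?k..t}"
    using int by (rule integrable_on_subinterval) (use h in auto)
  then have "norm (integral {h * real ?k..t} ?f) \<le> integral {h * real ?k..t} (\<lambda>s. C)"
    using bd by (intro integral_norm_bound_integral) auto
  moreover have "integral {h * real ?k..t} (\<lambda>s. C) = C * (t - h * real ?k)"
    using k by simp
  moreover have "C \<ge> 0" using order_trans[OF norm_ge_zero bd[of t]] k by simp
  then have "C * (t - h * real ?k) \<le> C * h"
    using k by (intro mult_left_mono) (auto simp: algebra_simps)
  ultimately show "norm (u 0 + integral {0..t} ?f - u ?k) \<le> C * h" by (metis order_trans)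
qed

text \<open>Setting all functions to 0 on \<open>N\<close> makes the convergence hold everywhere and
  leaves the integrals unchanged.\<close>

lemma dominated_convergence_negligible:
  fixes f :: "nat \<Rightarrow> 'n::euclidean_space \<Rightarrow> 'm::euclidean_space"
  assumes f: "\<And>k. f k integrable_on S" and h: "h integrable_on S"
    and le: "\<And>k x. x \<in> S \<Longrightarrow> norm (f k x) \<le> h x"
    and N: "negligible N"
    and conv: "\<And>x. x \<in> S - N \<Longrightarrow> (\<lambda>k. f k x) \<longlonglongrightarrow> g x"
  shows "g integrable_on S" "(\<lambda>k. integral S (f k)) \<longlonglongrightarrow> integral S g"
proof -
  let ?z = "\<lambda>f x. if x \<in> N then 0 else f x"
  have sp: "?z (f k) integrable_on S" for k
    using f[of k] N by (rule integrable_spike) auto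
  have le': "norm (?z (f k) x) \<le> h x" if "x \<in> S" for k x
    using le[OF that, of k] order_trans[OF norm_ge_zero le[OF that, of k]] by auto
  have cv: "(\<lambda>k. ?z (f k) x) \<longlonglongrightarrow> ?z g x" if "x \<in> S" for x
    using conv[of x] that by auto
  note dc = dominated_convergence[of "\<lambda>k. ?z (f k)" S h "?z g", OF sp h le' cv]
  show "g integrable_on S"
    using dc(1) N by (rule integrable_spike) auto
  have "integral S (?z (f k)) = integral S (f k)" for k
    using N by (rule integral_spike) auto
  moreover have "integral S (?z g) = integral S g"
    using N by (rule integral_spike) auto
  ultimately show "(\<lambda>k. integral S (f k)) \<longlonglongrightarrow> integral S g"
    using dc(2) by simp
qed

lemma euler_scheme:
  fixes F :: "real ^ 'n \<Rightarrow> (real ^ 'n) set"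
  assumes h: "h > 0" and ne: "F x0 \<noteq> {}"
    and A3: "\<And>x y v. v \<in> F x \<Longrightarrow> \<exists>w\<in>F y. \<forall>j. (x $ j - y $ j) * (v $ j - w $ j) \<ge> 0"
  shows "\<exists>u v. u 0 = x0 \<and> (\<forall>k. u (Suc k) = u k + h *\<^sub>R v k) \<and> (\<forall>k. v k \<in> F (u k)) \<and>
    (\<forall>k j. v k $ j * (v (Suc k) $ j - v k $ j) \<ge> 0)"
proof -
  obtain v0 where v0: "v0 \<in> F x0" using ne by blast
  \<comment> \<open>The state is a pair of position and velocity, since the next velocity is chosen
    relative to the current one. The clause for \<open>k = 0\<close> pins the initial state within
    the invariant of dependent choice.\<close>
  have "\<exists>p. \<forall>k. (snd (p k) \<in> F (fst (p k)) \<and> (k = 0 \<longrightarrow> p k = (x0, v0))) \<and>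
     (fst (p (Suc k)) = fst (p k) + h *\<^sub>R snd (p k) \<and>
      (\<forall>j. snd (p k) $ j * (snd (p (Suc k)) $ j - snd (p k) $ j) \<ge> 0))"
  proof (rule dependent_nat_choice)
    show "\<exists>p. snd p \<in> F (fst p) \<and> (0 = (0::nat) \<longrightarrow> p = (x0, v0))"
      using v0 by auto
  next
    fix p :: "(real^'n) \<times> (real^'n)" and k :: nat
    assume "snd p \<in> F (fst p) \<and> (k = 0 \<longrightarrow> p = (x0, v0))"
    then obtain w where w: "w \<in> F (fst p + h *\<^sub>R snd p)"
      "\<And>j. (fst p $ j - (fst p + h *\<^sub>R snd p) $ j) * (snd p $ j - w $ j) \<ge> 0"
      using A3[of "snd p" "fst p" "fst p + h *\<^sub>R snd p"] by blast
    have "snd p $ j * (w $ j - snd p $ j) \<ge> 0" for j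
    proof -
      have "h * (snd p $ j * (w $ j - snd p $ j)) \<ge> 0"
        using w(2)[of j] by (simp add: algebra_simps)
      then show ?thesis using h by (simp add: zero_le_mult_iff)
    qed
    then show "\<exists>q. (snd q \<in> F (fst q) \<and> (Suc k = 0 \<longrightarrow> q = (x0, v0))) \<and>
        fst q = fst p + h *\<^sub>R snd p \<and> (\<forall>j. snd p $ j * (snd q $ j - snd p $ j) \<ge> 0)"
      using w(1) by (intro exI[of _ "(fst p + h *\<^sub>R snd p, w)"]) auto
  qed
  then obtain p where p: "\<And>k. snd (p k) \<in> F (fst (p k))" "p 0 = (x0, v0)"
    "\<And>k. fst (p (Suc k)) = fst (p k) + h *\<^sub>R snd (p k)"
    "\<And>k j. snd (p k) $ j * (snd (p (Suc k)) $ j - snd (p k) $ j) \<ge> 0"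
    by blast
  then show ?thesis
    by (intro exI[of _ "\<lambda>k. fst (p k)"] exI[of _ "\<lambda>k. snd (p k)"]) auto
qed

theorem theorem1:
  fixes F :: "real ^ 'n \<Rightarrow> (real ^ 'n) set"
    and x0 :: "real ^ 'n"
    and T :: real
  assumes T_pos: "T > 0"
    and A1_values: "\<And>x. F x \<noteq> {} \<and> compact (F x)"
    and A1_graph: "closed {(x, v). v \<in> F x}"
    and A2: "\<exists>A B :: real. \<forall>x. set_norm (F x) \<le> A + B * norm x"
    and A3: "\<And>x y v. v \<in> F x \<Longrightarrow>
      \<exists>w\<in>F y. \<forall>j. (x $ j - y $ j) * (v $ j - w $ j) \<ge> 0"
  shows "\<exists>x. is_solution F x0 T x"
proof -

  \<comment> \<open>Growth estimate and uniformly bounded Euler schemes\<close>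
  obtain A B where AB: "\<And>x. set_norm (F x) \<le> A + B * norm x" using A2 by blast
  \<comment> \<open>Nonnegative and at least \<open>A\<close> and \<open>B\<close> whatever their
    signs, so that the growth bound takes the form \<open>M * (1 + norm x)\<close>.\<close>
  define M where "M = \<bar>A\<bar> + \<bar>B\<bar>"
  have M: "M \<ge> 0" by (simp add: M_def)
  have growth: "norm v \<le> M * (1 + norm x)" if "v \<in> F x" for x v
  proof -
    have "bounded (F x)" using A1_values compact_imp_bounded by blast
    \<comment> \<open>Boundedness above is what makes the real supremum in \<open>set_norm\<close>
      dominate the members of \<open>F x\<close>.\<close>
    then have "bdd_above (norm ` F x)"
      unfolding bounded_iff by (metis bdd_aboveI2)
    then have "norm v \<le> set_norm (F x)"
      unfolding set_norm_def using that by (intro cSUP_upper)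
    also have "\<dots> \<le> A + B * norm x" by (rule AB)
    also have "\<dots> \<le> M * 1 + M * norm x"
      by (intro add_mono mult_right_mono) (auto simp: M_def)
    finally show ?thesis by (simp add: algebra_simps)
  qed
  \<comment> \<open>The node with index \<open>Suc n\<close> falls exactly at time
    \<open>T\<close>.\<close>
  define h where "h n = T / real (Suc n)" for n
  have h: "h n > 0" for n using T_pos by (simp add: h_def)
  have hT: "h n * real k \<le> T \<longleftrightarrow> k \<le> Suc n" for n k
    using T_pos by (simp add: h_def field_simps del: of_nat_Suc)
  have "\<forall>n. \<exists>u v. u 0 = x0 \<and> (\<forall>k. u (Suc k) = u k + h n *\<^sub>R v k) \<and> (\<forall>k. v k \<in> F (u k)) \<and>
    (\<forall>k j. v k $ j * (v (Suc k) $ j - v k $ j) \<ge> 0)"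
    using euler_scheme[OF h, of F x0] A1_values A3 by blast
  then obtain u v where u0: "\<And>n. u n 0 = x0"
    and u: "\<And>n k. u n (Suc k) = u n k + h n *\<^sub>R v n k"
    and v: "\<And>n k. v n k \<in> F (u n k)"
    and sgn: "\<And>n k j. v n k $ j * (v n (Suc k) $ j - v n k $ j) \<ge> 0"
    unfolding choice_iff by blast
  \<comment> \<open>The linear growth estimate at the Gronwall bound for time \<open>T\<close>; it
    does not depend on \<open>n\<close>.\<close>
  define C where "C = M * (exp (M * T) * (1 + norm x0))"
  have vC: "norm (v n k) \<le> C" if "k \<le> Suc n" for n k
  proof -
    have "1 + norm (u n k) \<le> exp (M * (h n * real k)) * (1 + norm (u n 0))"
    proof (rule growth_bound)
      show "norm (u n (Suc k) - u n k) \<le> h n * (M * (1 + norm (u n k)))" for k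
        using growth[OF v[of n k]] h[of n] by (simp add: u)
    qed (use h[of n] M in auto)
    also have "\<dots> \<le> exp (M * T) * (1 + norm x0)"
      unfolding u0 using that M hT by (intro mult_right_mono) (auto intro: mult_left_mono)
    finally have "M * (1 + norm (u n k)) \<le> C"
      unfolding C_def using M by (rule mult_left_mono)
    with growth[OF v[of n k]] show ?thesis by linarith
  qed

  \<comment> \<open>Monotone velocity coordinates and Helly selection\<close>
  define f where "f n t = v n (nat \<lfloor>t / h n\<rfloor>)" for n t
  txt \<open>The index is capped because the Euler scheme is bounded uniformly in \<open>n\<close> only up to time \<open>T\<close>,
    while Helly's theorem is about functions on the whole line.\<close>
  define fc where "fc j n t = v n (min (Suc n) (nat \<lfloor>t / h n\<rfloor>)) $ j" for j n t
  \<comment> \<open>The value \<open>Suc n\<close> is attained at \<open>t = T\<close>; a cap at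
    \<open>Suc n\<close> therefore changes nothing on \<open>{0..T}\<close>.\<close>
  have idx: "nat \<lfloor>t / h n\<rfloor> \<le> Suc n" if "t \<in> {0..T}" for t n
  proof -
    have "h n * real (nat \<lfloor>t / h n\<rfloor>) \<le> t"
      using that h[of n] by (simp add: field_simps)
        (metis floor_divide_lower mult.commute)
    then have "h n * real (nat \<lfloor>t / h n\<rfloor>) \<le> T" using that by simp
    then show ?thesis by (simp only: hT)
  qed
  have fc: "fc j n t = f n t $ j" if "t \<in> {0..T}" for j n t
    using idx[OF that, of n] by (simp add: fc_def f_def min_absorb2)
  \<comment> \<open>The index is nondecreasing in \<open>t\<close>; the direction of monotonicity
    may vary with \<open>j\<close> and \<open>n\<close>.\<close>
  have "mono (fc j n) \<or> antimono (fc j n)" for j n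
  proof -
    have "min (Suc n) (nat \<lfloor>s / h n\<rfloor>) \<le> min (Suc n) (nat \<lfloor>t / h n\<rfloor>)" if "s \<le> t" for s t
      using that h[of n] by (intro min.mono nat_mono floor_mono divide_right_mono) auto
    moreover have "incseq (\<lambda>k. v n k $ j) \<or> decseq (\<lambda>k. v n k $ j)"
      using sgn by (rule incseq_or_decseq_if_no_sign_change)
    ultimately show ?thesis
      unfolding fc_def monotone_def by blast
  qed
  moreover have "continuous (at_right t) (fc j n)" for j n t
    unfolding fc_def using continuous_at_right_step[OF h, of t "\<lambda>k. v n (min (Suc n) k) $ j" n] .
  moreover have "\<bar>fc j n t\<bar> \<le> C" for j n t
    unfolding fc_def using component_le_norm_cart vC by (meson min.cobounded1 order_trans)
  ultimately obtain s G where s: "strict_mono (s::nat \<Rightarrow> nat)"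
    and Gc: "\<And>j. countable {t. \<not> isCont (G j) t}"
    and GC: "\<And>j t. \<bar>G j t\<bar> \<le> C"
    and Glim: "\<And>j t. isCont (G j) t \<Longrightarrow> (\<lambda>n. fc j (s n) t) \<longlonglongrightarrow> G j t"
    using Helly_selection_finite[of "UNIV :: 'n set" fc C] by (metis UNIV_I finite_class.finite_UNIV)

  \<comment> \<open>Limit velocity and convergence of the integrals\<close>
  define g :: "real \<Rightarrow> real ^ 'n" where "g t = (\<chi> j. G j t)" for t
  \<comment> \<open>A finite union of countable sets. Off \<open>N\<close> the velocities converge
    and their limit is continuous; the first gives the inclusion, the second the derivative.\<close>
  define N where "N = (\<Union>j. {t. \<not> isCont (G j) t})"
  have N: "negligible N"
    unfolding negligible_iff_null_sets N_def
    using Gc by (intro null_sets_completionI countable_imp_null_set_lborel countable_UN) auto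
  have gcont: "isCont g t" if "t \<notin> N" for t
    using that unfolding g_def N_def isCont_def by (intro tendsto_vec_lambda) auto
  have glim: "(\<lambda>n. f (s n) t) \<longlonglongrightarrow> g t" if "t \<in> {0..T} - N" for t
  proof (rule vec_tendstoI)
    fix j
    have "isCont (G j) t" using that by (auto simp: N_def)
    from Glim[OF this] show "(\<lambda>n. f (s n) t $ j) \<longlonglongrightarrow> g t $ j"
      using that by (simp add: fc g_def)
  qed
  have fC: "norm (f n t) \<le> C" if "t \<in> {0..T}" for n t
    unfolding f_def using idx[OF that] by (rule vC)
  \<comment> \<open>On \<open>N\<close> the value of \<open>g\<close> need not be a limit of
    velocities, so its norm is bounded through its coordinates, each of which is at most
    \<open>C\<close> in absolute value everywhere.\<close>
  define D where "D = real CARD('n) * C"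
  have gD: "norm (g t) \<le> D" for t
  proof -
    have "norm (g t) \<le> (\<Sum>j\<in>UNIV. \<bar>g t $ j\<bar>)" by (rule norm_le_l1_cart)
    also have "\<dots> \<le> (\<Sum>j\<in>(UNIV::'n set). C)" by (intro sum_mono) (simp add: g_def GC)
    finally show ?thesis by (simp add: D_def)
  qed
  have poly: "f n integrable_on {0..t}"
      "norm (x0 + integral {0..t} (f n) - u n (nat \<lfloor>t / h n\<rfloor>)) \<le> C * h n"
    if "t \<in> {0..T}" for n t
    using step_function_integral[of "h n" "u n" "v n" T C t] h u vC hT that
    unfolding f_def u0 by auto
  have gint: "g integrable_on {0..t}" "(\<lambda>n. integral {0..t} (f (s n))) \<longlonglongrightarrow> integral {0..t} g"
    if "t \<in> {0..T}" for t
    using dominated_convergence_negligible[of "\<lambda>n. f (s n)" "{0..t}" "\<lambda>_. C" N g]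
      poly(1)[OF that] fC glim N that by auto
  have "h \<longlonglongrightarrow> 0"
    unfolding h_def by (rule LIMSEQ_Suc[OF lim_const_over_n])
  from LIMSEQ_subseq_LIMSEQ[OF this s] have hlim: "(\<lambda>n. C * h (s n)) \<longlonglongrightarrow> 0"
    by (auto simp: o_def intro: tendsto_mult_right_zero)

  \<comment> \<open>The limit of the Euler polygons is a solution\<close>
  define x where "x t = x0 + integral {0..t} g" for t
  \<comment> \<open>The velocity \<open>f (s n) t\<close> lies in \<open>F\<close> at the last node,
    not at the polygon's value at \<open>t\<close>. The two points differ by at most
    \<open>C * h (s n)\<close>, so the nodes also tend to \<open>x t\<close> and the closed graph
    applies to the pairs of node and velocity.\<close>
  have incl: "g t \<in> F (x t)" if t: "t \<in> {0..T} - N" for t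
  proof -
    let ?u = "\<lambda>n. u (s n) (nat \<lfloor>t / h (s n)\<rfloor>)"
    have "(\<lambda>n. x0 + integral {0..t} (f (s n)) - ?u n) \<longlonglongrightarrow> 0"
      by (rule Lim_null_comparison[OF _ hlim]) (use poly(2) t in auto)
    moreover have "(\<lambda>n. x0 + integral {0..t} (f (s n))) \<longlonglongrightarrow> x t"
      unfolding x_def using gint(2) t by (intro tendsto_intros) auto
    ultimately have "?u \<longlonglongrightarrow> x t"
      using tendsto_diff by fastforce
    then have lim: "(\<lambda>n. (?u n, f (s n) t)) \<longlonglongrightarrow> (x t, g t)"
      using glim[OF t] by (rule tendsto_Pair)
    have "(?u n, f (s n) t) \<in> {(x, v). v \<in> F x}" for n
      using v by (simp add: f_def)
    from closed_sequentially[OF A1_graph this lim] show ?thesis by simp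
  qed
  \<comment> \<open>The fundamental theorem of calculus at a continuity point of \<open>g\<close>;
    the \<open>{}\<close> is the exceptional set of the differentiation rule.\<close>
  have deriv: "(x has_vector_derivative g t) (at t within {0..T})" if t: "t \<in> {0..T} - N" for t
  proof -
    have "((\<lambda>t. integral {0..t} g) has_vector_derivative g t) (at t within ({0..T} - {}))"
      using t gint(1)[of T] T_pos gcont[of t]
      by (intro integral_has_vector_derivative_continuous_at)
        (auto intro: continuous_at_imp_continuous_at_within)
    then show ?thesis
      unfolding x_def using has_vector_derivative_add[OF has_vector_derivative_const] by fastforce
  qed
  have "D-lipschitz_on {0..T} x"
  proof (rule lipschitz_onI)
    have le: "norm (x b - x a) \<le> D * (b - a)" if "0 \<le> a" "a \<le> b" "b \<le> T" for a b
    proof -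
      have int: "g integrable_on {0..b}" using gint(1) that by auto
      have "x b - x a = integral {a..b} g"
        unfolding x_def
        using Henstock_Kurzweil_Integration.integral_combine[OF that(1,2) int] by (simp add: algebra_simps)
      moreover have "g integrable_on {a..b}"
        using int by (rule integrable_on_subinterval) (use that in auto)
      then have "norm (integral {a..b} g) \<le> integral {a..b} (\<lambda>_. D)"
        using gD by (intro integral_norm_bound_integral) auto
      ultimately show ?thesis using that by (simp add: mult.commute)
    qed
    show "dist (x a) (x b) \<le> D * dist a b" if "a \<in> {0..T}" "b \<in> {0..T}" for a b
      using le[of a b] le[of b a] that by (cases "a \<le> b") (auto simp: dist_norm norm_minus_commute)
    show "0 \<le> D" using gD[of 0] norm_ge_zero order_trans by blast
  qed
  moreover have "AE t in lebesgue_on {0..T}.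
      \<exists>v\<in>F (x t). (x has_vector_derivative v) (at t within {0..T})"
  proof -
    have "AE t in lebesgue. t \<notin> N"
      using N by (simp add: negligible_iff_null_sets AE_not_in)
    then show ?thesis
      by (subst AE_restrict_space_iff) (use incl deriv in \<open>auto elim!: eventually_mono\<close>)
  qed
  moreover have "x 0 = x0" by (simp add: x_def)
  ultimately show ?thesis
    unfolding is_solution_def using lipschitz_on_imp_absolutely_continuous_on by blast
qed

end
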